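(* Let $\Delta$ and $\Delta'$ be finite thick generalized quadrangles, and let $\phi:\Delta\to\Delta'$ be a morphism which surjectively maps a geometrical hyperplane $\mathcal{G}$ of $\Delta$ to a geometrical hyperplane $\mathcal{G}'$ of $\Delta'$, i.e. $\phi(\mathcal{G})=\mathcal{G}'$. If $\mathcal{G}'$ is not of type B, then $\phi$ is surjective.
   Context: A point-line geometry is a weak generalized $4$-gon if any two elements (points or lines) lie in a common ordinary sub $4$-gon and there are no ordinary sub $k$-gons for $k=2,3$; it is a (thick) generalized quadrangle if moreover every point is on at least three lines and every line has at least three points. Order $(s,t)$ means that each line has $s+1$ points and each point is on $t+1$ lines. A morphism maps points to points, lines to lines, and preserves incidence. A geometrical hyperplane of a finite thick generalized quadrangle $\mathcal{S}$ of order $(s,t)$ is a subgeometry $\mathcal{S}'$ such that each line $U$ of $\mathcal{S}$ either contains exactly one point of $\mathcal{S}'$, and then $U$ is not a line of $\mathcal{S}'$, or has all its points in $\mathcal{S}'$, and then $U$ is a line of $\mathcal{S}'$. There are only three types: type A, $\mathcal{S}'$ is an ovoid of $\mathcal{S}$ (and has no lines); type B, $\mathcal{S}'$ is the point-line geometry of a set $x^{\perp}$ (the points collinear with or equal to $x$), with $x$ a point of $\mathcal{S}$, so that the lines of $\mathcal{S}'$ are exactly the lines of $\mathcal{S}$ incident with $x$; type C, $\mathcal{S}'$ is a (possibly thin) subquadrangle of order $(s,t/s)$. *)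

theory Defs
  imports Main
begin

record ('p, 'l) geometry =
  points :: "'p set"
  lines :: "'l set"
  incid :: "('p \<times> 'l) set"

definition point_line_geometry :: "('p, 'l) geometry \<Rightarrow> bool" where
  "point_line_geometry S \<longleftrightarrow> incid S \<subseteq> points S \<times> lines S"

definition finite_geometry :: "('p, 'l) geometry \<Rightarrow> bool" where
  "finite_geometry S \<longleftrightarrow> finite (points S) \<and> finite (lines S)"

text \<open>Subgeometries carry the induced incidence relation.\<close>

definition subgeometry :: "('p, 'l) geometry \<Rightarrow> ('p, 'l) geometry \<Rightarrow> bool" where
  "subgeometry H S \<longleftrightarrow>
     points H \<subseteq> points S \<and> lines H \<subseteq> lines S \<and>
     incid H = incid S \<inter> (points H \<times> lines H)"

text \<open>A cycle p 0, l 0, p 1, l 1, ..., p (k - 1), l (k - 1) of k distinct points and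
  k distinct lines, with no incidences besides those of the cycle.\<close>

definition ordinary_polygon :: "nat \<Rightarrow> ('p, 'l) geometry \<Rightarrow> bool" where
  "ordinary_polygon k C \<longleftrightarrow> 2 \<le> k \<and>
     (\<exists>p l. bij_betw p {..<k} (points C) \<and> bij_betw l {..<k} (lines C) \<and>
        incid C = (\<lambda>i. (p i, l i)) ` {..<k} \<union> (\<lambda>i. (p (Suc i mod k), l i)) ` {..<k})"

definition elements :: "('p, 'l) geometry \<Rightarrow> ('p + 'l) set" where
  "elements S = points S <+> lines S"

definition weak_generalized_quadrangle :: "('p, 'l) geometry \<Rightarrow> bool" where
  "weak_generalized_quadrangle S \<longleftrightarrow>
     point_line_geometry S \<and> elements S \<noteq> {} \<and>
     (\<forall>x\<in>elements S. \<forall>y\<in>elements S.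
        \<exists>C. subgeometry C S \<and> ordinary_polygon 4 C \<and> x \<in> elements C \<and> y \<in> elements C) \<and>
     (\<forall>k\<in>{2, 3}. \<not> (\<exists>C. subgeometry C S \<and> ordinary_polygon k C))"

definition points_on :: "('p, 'l) geometry \<Rightarrow> 'l \<Rightarrow> 'p set" where
  "points_on S U = {x \<in> points S. (x, U) \<in> incid S}"

definition lines_through :: "('p, 'l) geometry \<Rightarrow> 'p \<Rightarrow> 'l set" where
  "lines_through S x = {U \<in> lines S. (x, U) \<in> incid S}"

text \<open>Thickness is stated without cardinalities of whole pencils and point rows, which
  would be 0 for infinite sets.\<close>

definition generalized_quadrangle :: "('p, 'l) geometry \<Rightarrow> bool" where
  "generalized_quadrangle S \<longleftrightarrow>
     weak_generalized_quadrangle S \<and>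
     (\<forall>x\<in>points S. \<exists>A. A \<subseteq> lines_through S x \<and> card A = 3) \<and>
     (\<forall>U\<in>lines S. \<exists>A. A \<subseteq> points_on S U \<and> card A = 3)"

text \<open>The whole geometry satisfies the condition on lines; it is not a geometrical
  hyperplane, being neither an ovoid, nor a perp, nor a subquadrangle of order (s, t/s).\<close>

definition geometrical_hyperplane :: "('p, 'l) geometry \<Rightarrow> ('p, 'l) geometry \<Rightarrow> bool" where
  "geometrical_hyperplane H S \<longleftrightarrow>
     subgeometry H S \<and> H \<noteq> S \<and>
     (\<forall>U\<in>lines S.
        (\<exists>!x. x \<in> points_on S U \<and> x \<in> points H) \<and> U \<notin> lines H \<or>
        points_on S U \<subseteq> points H \<and> U \<in> lines H)"

definition collinear :: "('p, 'l) geometry \<Rightarrow> 'p \<Rightarrow> 'p \<Rightarrow> bool" where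
  "collinear S x y \<longleftrightarrow> (\<exists>U\<in>lines S. (x, U) \<in> incid S \<and> (y, U) \<in> incid S)"

definition perp :: "('p, 'l) geometry \<Rightarrow> 'p \<Rightarrow> 'p set" where
  "perp S x = {y \<in> points S. y = x \<or> collinear S x y}"

definition hyperplane_type_B :: "('p, 'l) geometry \<Rightarrow> ('p, 'l) geometry \<Rightarrow> bool" where
  "hyperplane_type_B H S \<longleftrightarrow>
     geometrical_hyperplane H S \<and>
     (\<exists>x\<in>points S. points H = perp S x \<and> lines H = lines_through S x)"

text \<open>A morphism is a pair of maps, on points and on lines; their values outside the
  source geometry are irrelevant.\<close>

definition morphism ::
    "('p, 'l) geometry \<Rightarrow> ('q, 'm) geometry \<Rightarrow> ('p \<Rightarrow> 'q) \<Rightarrow> ('l \<Rightarrow> 'm) \<Rightarrow> bool" where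
  "morphism S T f g \<longleftrightarrow>
     f ` points S \<subseteq> points T \<and> g ` lines S \<subseteq> lines T \<and>
     (\<forall>x\<in>points S. \<forall>U\<in>lines S. (x, U) \<in> incid S \<longrightarrow> (f x, g U) \<in> incid T)"

definition maps_onto ::
    "('p, 'l) geometry \<Rightarrow> ('q, 'm) geometry \<Rightarrow> ('p \<Rightarrow> 'q) \<Rightarrow> ('l \<Rightarrow> 'm) \<Rightarrow> bool" where
  "maps_onto S T f g \<longleftrightarrow> f ` points S = points T \<and> g ` lines S = lines T"

end

theory Submission
  imports Defs
begin

text \<open>Suppose some line U is mapped outside G', and let w be a point off G' on the image of U. Every
  other line M through w meets G' in the image of some z in G, and the projection of z on U is mapped
  to the projection of that image, so w and M are images. As the complement of G' is connected,
  everything is an image. If all lines are mapped into G', then G', not being of type B, is itself a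
  (possibly thin) quadrangle with at least two lines on each point. Two lines on a common point with
  equal images are then impossible, by counting a fibre. But a line U not in G meets G in a point x,
  and projecting x on a suitable line of G gives a line of G through x with the same image as U.\<close>

text \<open>These properties hold in thick generalized quadrangles and also in the hyperplanes
  treated below. Lines have at least three points, but a point need only be on two lines, because a
  hyperplane of type C may be thin.\<close>

locale quadrangle =
  fixes S :: "('p, 'l) geometry"
  assumes incid_point: "(x, U) \<in> incid S \<Longrightarrow> x \<in> points S"
    and incid_line: "(x, U) \<in> incid S \<Longrightarrow> U \<in> lines S"
    and unique_line: "\<lbrakk>(x, U) \<in> incid S; (y, U) \<in> incid S; (x, V) \<in> incid S; (y, V) \<in> incid S; x \<noteq> y\<rbrakk>
      \<Longrightarrow> U = V"
    and no_triangle: "\<lbrakk>(x, U) \<in> incid S; (y, U) \<in> incid S; (y, V) \<in> incid S; (z, V) \<in> incid S;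
      (z, W) \<in> incid S; (x, W) \<in> incid S; x \<noteq> y; y \<noteq> z; x \<noteq> z\<rbrakk> \<Longrightarrow> U = V"
    and projection: "\<lbrakk>x \<in> points S; U \<in> lines S; (x, U) \<notin> incid S\<rbrakk>
      \<Longrightarrow> \<exists>w V. (x, V) \<in> incid S \<and> (w, V) \<in> incid S \<and> (w, U) \<in> incid S"
    and third_point: "U \<in> lines S \<Longrightarrow> \<exists>c. (c, U) \<in> incid S \<and> c \<noteq> a \<and> c \<noteq> b"
    and second_line: "x \<in> points S \<Longrightarrow> \<exists>V. (x, V) \<in> incid S \<and> V \<noteq> U"
begin

text \<open>Two different feet on \<open>U\<close> would form a triangle with \<open>x\<close>,
  which forces \<open>x\<close> onto \<open>U\<close>.\<close>

lemma projection_unique: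
  assumes "(x, U) \<notin> incid S"
    and "(x, V) \<in> incid S" "(w, V) \<in> incid S" "(w, U) \<in> incid S"
    and "(x, V') \<in> incid S" "(w', V') \<in> incid S" "(w', U) \<in> incid S"
  shows "w = w' \<and> V = V'"
proof -
  have "w = w'"
  proof (rule ccontr)
    assume "w \<noteq> w'"
    then have "V = U"
      using no_triangle[of x V w U w' V'] assms by blast
    then show False using assms by blast
  qed
  then show ?thesis using unique_line[of x V w V'] assms by blast
qed

end

subsection \<open>Generalized quadrangles\<close>

lemma ordinary_digon:
  assumes "x \<noteq> y" "U \<noteq> V"
  shows "ordinary_polygon 2 \<lparr>points = {x, y}, lines = {U, V}, incid = {x, y} \<times> {U, V}\<rparr>"
proof -
  have below: "{..<2} = {0, 1::nat}" by auto
  have "bij_betw ((!) [x, y]) {..<2} {x, y}" "bij_betw ((!) [U, V]) {..<2} {U, V}"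
    using assms by (auto intro!: bij_betw_nth)
  moreover have "{x, y} \<times> {U, V} = (\<lambda>i. ([x, y] ! i, [U, V] ! i)) ` {..<2} \<union>
      (\<lambda>i. ([x, y] ! (Suc i mod 2), [U, V] ! i)) ` {..<2}"
    unfolding below by auto
  ultimately show ?thesis unfolding ordinary_polygon_def by force
qed

lemma ordinary_triangle:
  assumes "distinct [x, y, z]" "distinct [U, V, W]"
  shows "ordinary_polygon 3 \<lparr>points = {x, y, z}, lines = {U, V, W},
    incid = {(x, U), (y, U), (y, V), (z, V), (z, W), (x, W)}\<rparr>"
proof -
  have below: "{..<3} = {0, 1, 2::nat}" by auto
  have "bij_betw ((!) [x, y, z]) {..<3} {x, y, z}" "bij_betw ((!) [U, V, W]) {..<3} {U, V, W}"
    using assms by (auto intro!: bij_betw_nth)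
  moreover have "{(x, U), (y, U), (y, V), (z, V), (z, W), (x, W)} =
      (\<lambda>i. ([x, y, z] ! i, [U, V, W] ! i)) ` {..<3} \<union>
      (\<lambda>i. ([x, y, z] ! (Suc i mod 3), [U, V, W] ! i)) ` {..<3}"
    unfolding below by auto
  ultimately show ?thesis unfolding ordinary_polygon_def by force
qed

text \<open>A line of a 4-cycle contains two consecutive points, and each of the other two points is
  joined to one of these by a line of the cycle.\<close>

lemma ordinary_quadrangle_projection:
  assumes "ordinary_polygon 4 C" "x \<in> points C" "U \<in> lines C" "(x, U) \<notin> incid C"
  shows "\<exists>w V. (x, V) \<in> incid C \<and> (w, V) \<in> incid C \<and> (w, U) \<in> incid C"
proof -
  obtain p l where p: "bij_betw p {..<4} (points C)" and l: "bij_betw l {..<4} (lines C)"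
    and inc: "incid C = (\<lambda>i. (p i, l i)) ` {..<4} \<union> (\<lambda>i. (p (Suc i mod 4), l i)) ` {..<4}"
    using assms(1) unfolding ordinary_polygon_def by blast
  have same: "(p i, l i) \<in> incid C" if "i < 4" for i using that unfolding inc by blast
  have succ: "(p (Suc i mod 4), l i) \<in> incid C" if "i < 4" for i using that unfolding inc by blast
  have flags: "(p 0, l 0) \<in> incid C" "(p 1, l 1) \<in> incid C" "(p 2, l 2) \<in> incid C"
    "(p 3, l 3) \<in> incid C" "(p 1, l 0) \<in> incid C" "(p 2, l 1) \<in> incid C" "(p 3, l 2) \<in> incid C"
    "(p 0, l 3) \<in> incid C"
    using same[of 0] same[of 1] same[of 2] same[of 3] succ[of 0] succ[of 1] succ[of 2] succ[of 3]
    by (simp_all flip: numeral_2_eq_2)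
  obtain i where i: "x = p i" "i < 4" using p assms(2) unfolding bij_betw_def by blast
  obtain j where j: "U = l j" "j < 4" using l assms(3) unfolding bij_betw_def by blast
  have "i = 0 \<or> i = 1 \<or> i = 2 \<or> i = 3" "j = 0 \<or> j = 1 \<or> j = 2 \<or> j = 3"
    using i(2) j(2) by linarith+
  then show ?thesis
    using assms(4) flags unfolding i(1) j(1) by (elim disjE; hypsubst; blast)
qed

lemma common_ordinary_quadrangle:
  assumes "weak_generalized_quadrangle S" "x \<in> elements S" "y \<in> elements S"
  shows "\<exists>C. subgeometry C S \<and> ordinary_polygon 4 C \<and> x \<in> elements C \<and> y \<in> elements C"
proof -
  have "\<forall>x\<in>elements S. \<forall>y\<in>elements S.
      \<exists>C. subgeometry C S \<and> ordinary_polygon 4 C \<and> x \<in> elements C \<and> y \<in> elements C"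
    using assms(1) unfolding weak_generalized_quadrangle_def by (elim conjE)
  then show ?thesis using assms(2,3) by simp
qed

text \<open>The absence of sub 2-gons and 3-gons gives \<open>unique_line\<close> and
  \<open>no_triangle\<close>; an ordinary 4-gon containing a given point and a given line gives
  \<open>projection\<close>.\<close>

lemma generalized_quadrangle_quadrangle:
  assumes "generalized_quadrangle S"
  shows "quadrangle S"
proof -
  have W: "weak_generalized_quadrangle S"
    using assms unfolding generalized_quadrangle_def by blast
  have thick_point: "\<forall>x\<in>points S. \<exists>A. A \<subseteq> lines_through S x \<and> card A = 3"
    and thick_line: "\<forall>U\<in>lines S. \<exists>A. A \<subseteq> points_on S U \<and> card A = 3"
    using assms unfolding generalized_quadrangle_def by simp_all
  have inc: "incid S \<subseteq> points S \<times> lines S"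
    using W
    unfolding weak_generalized_quadrangle_def point_line_geometry_def by blast
  have no2: "\<not> (subgeometry C S \<and> ordinary_polygon 2 C)"
    and no3: "\<not> (subgeometry C S \<and> ordinary_polygon 3 C)" for C
    using W unfolding weak_generalized_quadrangle_def by blast+
  have uniq: "U = V" if "(x, U) \<in> incid S" "(y, U) \<in> incid S" "(x, V) \<in> incid S" "(y, V) \<in> incid S"
      "x \<noteq> y" for x y U V
  proof (rule ccontr)
    assume "U \<noteq> V"
    moreover have "subgeometry \<lparr>points = {x, y}, lines = {U, V}, incid = {x, y} \<times> {U, V}\<rparr> S"
      using that inc unfolding subgeometry_def by auto
    ultimately show False using ordinary_digon that(5) no2 by metis
  qed
  have tri: "U = V" if *: "(x, U) \<in> incid S" "(y, U) \<in> incid S" "(y, V) \<in> incid S" "(z, V) \<in> incid S"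
      "(z, W) \<in> incid S" "(x, W) \<in> incid S" and ne: "x \<noteq> y" "y \<noteq> z" "x \<noteq> z" for x y z U V W
  proof (rule ccontr)
    assume UV: "U \<noteq> V"
    have UW: "U \<noteq> W" using uniq[of y U z V] * ne UV by blast
    have VW: "V \<noteq> W" using uniq[of x U y V] * ne UV by blast
    \<comment> \<open>Subgeometries are induced, so the three points and lines form an ordinary
      triangle only if there are no further incidences among them.\<close>
    have off: "(x, V) \<notin> incid S" "(z, U) \<notin> incid S" "(y, W) \<notin> incid S"
      using uniq[of x U y V] uniq[of y U z V] uniq[of x U y W] * ne UV UW by blast+
    have "subgeometry \<lparr>points = {x, y, z}, lines = {U, V, W},
        incid = {(x, U), (y, U), (y, V), (z, V), (z, W), (x, W)}\<rparr> S"
      using * off inc unfolding subgeometry_def by auto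
    moreover have "distinct [x, y, z]" "distinct [U, V, W]" using ne UV UW VW by auto
    ultimately show False using ordinary_triangle no3 by metis
  qed
  show ?thesis
  proof
    show "x \<in> points S" "U \<in> lines S" if "(x, U) \<in> incid S" for x U using that inc by auto
    show "U = V" if "(x, U) \<in> incid S" "(y, U) \<in> incid S" "(x, V) \<in> incid S" "(y, V) \<in> incid S"
      "x \<noteq> y" for x y U V using uniq that by blast
    show "U = V" if "(x, U) \<in> incid S" "(y, U) \<in> incid S" "(y, V) \<in> incid S" "(z, V) \<in> incid S"
      "(z, W) \<in> incid S" "(x, W) \<in> incid S" "x \<noteq> y" "y \<noteq> z" "x \<noteq> z" for x y z U V W
      using tri that by blast
    show "\<exists>w V. (x, V) \<in> incid S \<and> (w, V) \<in> incid S \<and> (w, U) \<in> incid S"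
      if "x \<in> points S" "U \<in> lines S" "(x, U) \<notin> incid S" for x U
    proof -
      have "Inl x \<in> elements S" "Inr U \<in> elements S" using that by (auto simp: elements_def)
      then obtain C where C: "subgeometry C S" "ordinary_polygon 4 C"
          "Inl x \<in> elements C" "Inr U \<in> elements C"
        using common_ordinary_quadrangle[OF W] by meson
      then have "x \<in> points C" "U \<in> lines C" by (auto simp: elements_def)
      moreover have "incid C = incid S \<inter> (points C \<times> lines C)" using C unfolding subgeometry_def by blast
      ultimately show ?thesis using ordinary_quadrangle_projection[OF C(2), of x U] that by blast
    qed
    show "\<exists>c. (c, U) \<in> incid S \<and> c \<noteq> a \<and> c \<noteq> b" if "U \<in> lines S" for U a b
    proof -
      obtain A where A: "A \<subseteq> points_on S U" "card A = 3"
        using thick_line \<open>U \<in> lines S\<close> by meson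
      have "card {a, b} \<le> 2" by (simp add: card_insert_if)
      then have "\<not> A \<subseteq> {a, b}" using A(2) card_mono[of "{a, b}" A] by auto
      then show ?thesis using A(1) unfolding points_on_def by blast
    qed
    show "\<exists>V. (x, V) \<in> incid S \<and> V \<noteq> U" if "x \<in> points S" for x U
    proof -
      obtain A where A: "A \<subseteq> lines_through S x" "card A = 3"
        using thick_point \<open>x \<in> points S\<close> by meson
      then have "\<not> A \<subseteq> {U}" using card_mono[of "{U}" A] by auto
      then show ?thesis using A(1) unfolding lines_through_def by blast
    qed
  qed
qed

subsection \<open>Geometrical hyperplanes\<close>

locale hyperplane = quadrangle S for S :: "('p, 'l) geometry" +
  fixes H :: "('p, 'l) geometry"
  assumes hyperplane: "geometrical_hyperplane H S"
begin

section \<open>Lines and points relative to a hyperplane\<close>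

lemma points_subset: "points H \<subseteq> points S" and lines_subset: "lines H \<subseteq> lines S"
  and incid_iff: "(x, U) \<in> incid H \<longleftrightarrow> (x, U) \<in> incid S \<and> x \<in> points H \<and> U \<in> lines H"
  using hyperplane unfolding geometrical_hyperplane_def subgeometry_def by auto

lemma line_cases: "U \<in> lines S \<Longrightarrow>
    (\<exists>!x. x \<in> points_on S U \<and> x \<in> points H) \<and> U \<notin> lines H \<or>
    points_on S U \<subseteq> points H \<and> U \<in> lines H"
  using hyperplane unfolding geometrical_hyperplane_def by blast

lemma point_on_line:
  assumes "(x, U) \<in> incid S" "U \<in> lines H"
  shows "x \<in> points H"
  using line_cases[OF incid_line[OF assms(1)]] assms incid_point[OF assms(1)]
  unfolding points_on_def by blast

lemma line_meets:
  assumes "U \<in> lines S"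
  shows "\<exists>x\<in>points H. (x, U) \<in> incid S"
proof (cases "U \<in> lines H")
  case True
  obtain c where "(c, U) \<in> incid S" using third_point[OF assms] by blast
  then show ?thesis using point_on_line True by blast
next
  case False
  then show ?thesis using line_cases[OF assms] unfolding points_on_def by blast
qed

lemma line_in_hyperplane:
  assumes "(x, U) \<in> incid S" "(y, U) \<in> incid S" "x \<in> points H" "y \<in> points H" "x \<noteq> y"
  shows "U \<in> lines H"
  using line_cases[OF incid_line[OF assms(1)]] assms incid_point[OF assms(1)] incid_point[OF assms(2)]
  unfolding points_on_def by blast

text \<open>The line has exactly one point in \<open>H\<close>; thickness provides a point different
  from that one and from \<open>a\<close>.\<close>

lemma point_off_hyperplane:
  assumes "U \<in> lines S" "U \<notin> lines H"
  shows "\<exists>y. (y, U) \<in> incid S \<and> y \<notin> points H \<and> y \<noteq> a"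
proof -
  obtain x where x: "x \<in> points H" "(x, U) \<in> incid S" using line_meets assms by blast
  obtain y where "(y, U) \<in> incid S" "y \<noteq> a" "y \<noteq> x" using third_point assms by blast
  then show ?thesis using line_in_hyperplane x assms by blast
qed

text \<open>Connectedness of the collinearity graph off \<open>H\<close>, as an induction rule. If
  \<open>w\<close> were not reached, two points of a line \<open>A\<close> through \<open>y\<close>
  would project to the same point of a line through \<open>w\<close> disjoint from \<open>A\<close>,
  giving a triangle.\<close>

lemma complement_connected:
  assumes y: "y \<in> points S" "y \<notin> points H" "P y"
    and step: "\<And>x z U. \<lbrakk>P x; x \<notin> points H; z \<notin> points H; (x, U) \<in> incid S; (z, U) \<in> incid S\<rbrakk> \<Longrightarrow> P z"
    and w: "w \<in> points S" "w \<notin> points H"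
  shows "P w"
proof (rule ccontr)
  assume nP: "\<not> P w"
  \<comment> \<open>A point \<open>v\<close> off \<open>H\<close> collinear with both
    \<open>x\<close> and \<open>w\<close> would carry \<open>P\<close> from \<open>x\<close> to
    \<open>w\<close>.\<close>
  have proj: "v \<in> points H"
    if "P x" "x \<notin> points H" "(x, A) \<in> incid S" "(v, A) \<in> incid S" "(v, C) \<in> incid S" "(w, C) \<in> incid S"
    for x v A C
    using step[OF that(1,2) _ that(3,4)] step[of v w C] that w nP by blast
  obtain A where A: "(y, A) \<in> incid S" using second_line y by blast
  then have "A \<in> lines S" "A \<notin> lines H" using incid_line point_on_line y by blast+
  then obtain u where u: "(u, A) \<in> incid S" "u \<notin> points H" "u \<noteq> y"
    using point_off_hyperplane by blast
  have Pu: "P u" using step y u A by blast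
  have nA: "(w, A) \<notin> incid S" using step y w A nP by blast
  obtain v0 C0 where C0: "(w, C0) \<in> incid S" "(v0, C0) \<in> incid S" "(v0, A) \<in> incid S"
    using projection[of w A] w nA incid_line A by blast
  \<comment> \<open>Only \<open>C0\<close> joins \<open>w\<close> to \<open>A\<close>, so any other
    line through \<open>w\<close> is disjoint from \<open>A\<close>.\<close>
  obtain C where C: "(w, C) \<in> incid S" "C \<noteq> C0" using second_line w by blast
  have disj: "(v, A) \<notin> incid S" if "(v, C) \<in> incid S" for v
    using projection_unique[OF nA C0 C(1) that] C(2) by blast
  have ny: "(y, C) \<notin> incid S" and nu: "(u, C) \<notin> incid S" using disj A u by blast+
  obtain v1 B1 where v1: "(y, B1) \<in> incid S" "(v1, B1) \<in> incid S" "(v1, C) \<in> incid S"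
    using projection[OF y(1) incid_line[OF C(1)] ny] by blast
  obtain v2 B2 where v2: "(u, B2) \<in> incid S" "(v2, B2) \<in> incid S" "(v2, C) \<in> incid S"
    using projection[OF incid_point[OF u(1)] incid_line[OF C(1)] nu] by blast
  have "v1 \<in> points H" "v2 \<in> points H"
    using proj[OF y(3,2) v1 C(1)] proj[OF Pu u(2) v2 C(1)] by blast+
  \<comment> \<open>As \<open>w\<close> is off \<open>H\<close>, the line \<open>C\<close> has a
    single point in \<open>H\<close>, so both projections are that point.\<close>
  moreover have "C \<notin> lines H" using point_on_line C w by blast
  ultimately have "v1 = v2" using line_in_hyperplane v1 v2 by blast
  moreover have "v1 \<noteq> y" "v1 \<noteq> u" using v1 ny nu by blast+
  ultimately have "A = B2"
    using no_triangle[of y A u B2 v1 B1] A u v1 v2 by blast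
  then show False using v2 disj by blast
qed

section \<open>Hyperplanes that have lines and are not of type B\<close>

lemma projection_in_hyperplane:
  assumes "x \<in> points H" "U \<in> lines H" "(x, U) \<notin> incid S"
  shows "\<exists>w V. V \<in> lines H \<and> w \<in> points H \<and> (x, V) \<in> incid S \<and> (w, V) \<in> incid S \<and> (w, U) \<in> incid S"
proof -
  obtain w V where V: "(x, V) \<in> incid S" "(w, V) \<in> incid S" "(w, U) \<in> incid S"
    using projection assms points_subset lines_subset by blast
  \<comment> \<open>The foot lies on a line of \<open>H\<close>, hence in \<open>H\<close>; the
    joining line then has two points in \<open>H\<close> and so belongs to it.\<close>
  then have "w \<in> points H" using point_on_line assms by blast
  moreover have "w \<noteq> x" using V assms by blast
  ultimately show ?thesis using line_in_hyperplane V assms by blast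
qed

text \<open>Projecting a point of \<open>H\<close> on \<open>L\<close> uses a line of
  \<open>H\<close>, hence a line through \<open>c\<close>, so \<open>points H\<close> lies in the
  perp of \<open>c\<close>. It remains to see that all lines through \<open>c\<close> are in
  \<open>H\<close>.\<close>

lemma type_B_if_concurrent:
  assumes c: "c \<in> points S" "(c, L) \<in> incid S" "L \<in> lines H"
    and conc: "\<And>N. N \<in> lines H \<Longrightarrow> (c, N) \<in> incid S"
  shows "hyperplane_type_B H S"
proof -
  have sub: "points H \<subseteq> perp S c"
  proof
    fix y assume y: "y \<in> points H"
    have "\<exists>V. (c, V) \<in> incid S \<and> (y, V) \<in> incid S"
    proof (cases "(y, L) \<in> incid S")
      case True then show ?thesis using c by blast
    next
      case False
      then show ?thesis using projection_in_hyperplane[OF y c(3)] conc by blast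
    qed
    then show "y \<in> perp S c"
      using y points_subset incid_line unfolding perp_def collinear_def by blast
  qed
  have lines: "V \<in> lines H" if V: "(c, V) \<in> incid S" for V
  proof -
    obtain v where v: "(v, V) \<in> incid S" "v \<noteq> c" using third_point incid_line[OF V] by blast
    obtain W where W: "(v, W) \<in> incid S" "W \<noteq> V" using second_line incid_point[OF v(1)] by blast
    \<comment> \<open>The point of \<open>H\<close> on \<open>W\<close> is collinear with
      \<open>c\<close>, so it must be \<open>v\<close> itself, as otherwise \<open>c\<close>,
      \<open>v\<close>, \<open>h\<close> is a triangle.\<close>
    obtain h where h: "h \<in> points H" "(h, W) \<in> incid S" using line_meets incid_line[OF W(1)] by blast
    have hc: "h \<noteq> c" using unique_line W V v h by blast
    then obtain X where X: "(c, X) \<in> incid S" "(h, X) \<in> incid S"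
      using sub h unfolding perp_def collinear_def by blast
    have "h = v"
      using no_triangle[of c V v W h X] V v W h X hc by blast
    then have "v \<in> points H" using h by blast
    moreover have "c \<in> points H" using point_on_line c by blast
    ultimately show ?thesis using line_in_hyperplane V v by blast
  qed
  have "perp S c \<subseteq> points H"
    using lines point_on_line c unfolding perp_def collinear_def by blast
  moreover have "lines H = lines_through S c"
    using lines conc lines_subset incid_line unfolding lines_through_def by blast
  ultimately show ?thesis
    using sub hyperplane c unfolding hyperplane_type_B_def by blast
qed

text \<open>If a point \<open>z\<close> of \<open>H\<close> is on only one line \<open>L\<close> of
  \<open>H\<close>, then projecting \<open>z\<close> shows that every line of \<open>H\<close> meets
  \<open>L\<close>. All lines of \<open>H\<close> then turn out to be concurrent, which is type
  B.\<close>

lemma second_line_in_hyperplane: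
  assumes nB: "\<not> hyperplane_type_B H S" and ne: "lines H \<noteq> {}" and z: "z \<in> points H"
  shows "\<exists>V. V \<in> lines H \<and> (z, V) \<in> incid S \<and> V \<noteq> U"
proof (rule ccontr)
  assume no: "\<not> ?thesis"
  obtain L where L: "L \<in> lines H" "(z, L) \<in> incid S"
    using ne projection_in_hyperplane[OF z] by blast
  have only: "V = L" if "V \<in> lines H" "(z, V) \<in> incid S" for V using no that L by blast
  have meet: "\<exists>c. (c, N) \<in> incid S \<and> (c, L) \<in> incid S" if N: "N \<in> lines H" for N
  proof (cases "(z, N) \<in> incid S")
    case False
    then show ?thesis using projection_in_hyperplane[OF z N] only by blast
  qed (use L in blast)
  have cross: "(c, N) \<in> incid S"
    if c: "(c, L) \<in> incid S" "(c, M) \<in> incid S" "M \<noteq> L" "M \<in> lines H" and N: "N \<in> lines H" for c M N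
  proof (rule ccontr)
    assume nc: "(c, N) \<notin> incid S"
    then have NL: "N \<noteq> L" using c by blast
    obtain d where d: "(d, N) \<in> incid S" "(d, L) \<in> incid S" using meet N by blast
    have dc: "d \<noteq> c" using nc d by blast
    have "M \<in> lines S" using c lines_subset by blast
    then obtain m where m: "(m, M) \<in> incid S" "m \<noteq> c" using third_point by blast
    have mL: "(m, L) \<notin> incid S" using unique_line m c by blast
    have mN: "(m, N) \<notin> incid S"
      using projection_unique[OF mL m(1) c(2,1) _ d] dc by blast
    have "m \<in> points H" using point_on_line m c by blast
    then obtain n R where R: "R \<in> lines H" "(m, R) \<in> incid S" "(n, R) \<in> incid S" "(n, N) \<in> incid S"
      using projection_in_hyperplane[OF _ N mN] by blast
    obtain e where e: "(e, R) \<in> incid S" "(e, L) \<in> incid S" using meet R by blast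
    \<comment> \<open>Like every line of \<open>H\<close>, \<open>R\<close> meets \<open>L\<close>,
      and \<open>M\<close> is the only line joining \<open>m\<close> to \<open>L\<close>. So
      \<open>M\<close> meets \<open>N\<close> in a point \<open>n\<close>, which would project on
      \<open>L\<close> to both \<open>c\<close> and \<open>d\<close>.\<close>
    have "R = M" using projection_unique[OF mL m(1) c(2,1) R(2) e] by blast
    then have nM: "(n, M) \<in> incid S" using R by blast
    have nL: "(n, L) \<notin> incid S" using unique_line[of c M n L] c nM nc R by blast
    show False using projection_unique[OF nL nM c(2,1) R(4) d] dc by blast
  qed
  show False
  proof (cases "\<exists>M\<in>lines H. M \<noteq> L")
    case True
    then obtain M where M: "M \<in> lines H" "M \<noteq> L" by blast
    then obtain c where c: "(c, M) \<in> incid S" "(c, L) \<in> incid S" using meet by blast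
    show False
      using type_B_if_concurrent[OF incid_point[OF c(1)] c(2) L(1)] cross[OF c(2,1) M(2,1)] nB by blast
  next
    case False
    then have "(z, N) \<in> incid S" if "N \<in> lines H" for N using that L by metis
    then show False
      using type_B_if_concurrent[OF incid_point[OF L(2)] L(2) L(1)] nB by blast
  qed
qed

text \<open>Lines of \<open>H\<close> keep all their points and projections stay in
  \<open>H\<close>; excluding type B supplies the second line on each point.\<close>

lemma quadrangle_hyperplane:
  assumes "\<not> hyperplane_type_B H S" "lines H \<noteq> {}"
  shows "quadrangle H"
proof
  show "x \<in> points H" "U \<in> lines H" if "(x, U) \<in> incid H" for x U using that incid_iff by auto
  show "U = V" if "(x, U) \<in> incid H" "(y, U) \<in> incid H" "(x, V) \<in> incid H" "(y, V) \<in> incid H"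
    "x \<noteq> y" for x y U V using unique_line that incid_iff by blast
  show "U = V" if "(x, U) \<in> incid H" "(y, U) \<in> incid H" "(y, V) \<in> incid H" "(z, V) \<in> incid H"
    "(z, W) \<in> incid H" "(x, W) \<in> incid H" "x \<noteq> y" "y \<noteq> z" "x \<noteq> z" for x y z U V W
    using no_triangle[of x U y V z W] that incid_iff by blast
  show "\<exists>w V. (x, V) \<in> incid H \<and> (w, V) \<in> incid H \<and> (w, U) \<in> incid H"
    if "x \<in> points H" "U \<in> lines H" "(x, U) \<notin> incid H" for x U
    using projection_in_hyperplane[of x U] that incid_iff by blast
  show "\<exists>c. (c, U) \<in> incid H \<and> c \<noteq> a \<and> c \<noteq> b" if "U \<in> lines H" for U a b
    using third_point[of U a b] point_on_line[OF _ that] that lines_subset incid_iff by blast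
  show "\<exists>V. (x, V) \<in> incid H \<and> V \<noteq> U" if "x \<in> points H" for x U
    using second_line_in_hyperplane[OF assms that] that incid_iff by blast
qed

text \<open>Every point is on a line, so a hyperplane with all the lines would be the whole
  geometry, which the definition excludes.\<close>

lemma line_off_hyperplane:
  assumes "point_line_geometry S"
  shows "\<exists>U\<in>lines S. U \<notin> lines H"
proof (rule ccontr)
  assume "\<not> ?thesis"
  then have lines: "lines H = lines S" using lines_subset by blast
  have "points H = points S"
    using points_subset second_line point_on_line incid_line lines by blast
  moreover from this lines have "incid H = incid S"
    using incid_iff incid_point incid_line by auto
  ultimately have "H = S" using lines by (simp add: geometry.equality)
  then show False using hyperplane unfolding geometrical_hyperplane_def by blast
qed

end

subsection \<open>Epimorphisms from finite quadrangles\<close>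

text \<open>To be applied with the hyperplane of the second quadrangle as target, under the
  assumption that all lines are mapped into it.\<close>

locale epimorphism = D: quadrangle S + T: quadrangle T
  for S :: "('p, 'l) geometry" and T :: "('q, 'm) geometry" +
  fixes f :: "'p \<Rightarrow> 'q" and g :: "'l \<Rightarrow> 'm"
  assumes incid: "(x, U) \<in> incid S \<Longrightarrow> (f x, g U) \<in> incid T"
    and surj_points: "y \<in> points T \<Longrightarrow> \<exists>x\<in>points S. f x = y"
    and surj_lines: "M \<in> lines T \<Longrightarrow> \<exists>U\<in>lines S. g U = M"
    and finite_points: "finite (points S)"
    and finite_lines: "finite (lines S)"
begin

section \<open>Sizes of the local fibres\<close>

definition pencil :: "'p \<Rightarrow> 'm \<Rightarrow> 'l set" where
  "pencil x M = {U. (x, U) \<in> incid S \<and> g U = M}"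

definition row :: "'l \<Rightarrow> 'q \<Rightarrow> 'p set" where
  "row U y = {x. (x, U) \<in> incid S \<and> f x = y}"

lemma finite_pencil: "finite (pencil x M)"
  by (rule finite_subset[OF _ finite_lines]) (auto simp: pencil_def D.incid_line)

lemma finite_row: "finite (row U y)"
  by (rule finite_subset[OF _ finite_points]) (auto simp: row_def D.incid_point)

text \<open>For a line \<open>N\<close> through \<open>z\<close> over \<open>L\<close>, the line
  from \<open>u\<close> to \<open>N\<close> is over \<open>K\<close>, because \<open>f u\<close>
  projects to \<open>v\<close> on \<open>L\<close>. It determines \<open>N\<close> as the line
  joining \<open>z\<close> to it.\<close>

lemma card_pencil_le:
  assumes v: "(v, L) \<in> incid T" "(v, K) \<in> incid T" "L \<noteq> K"
    and z: "z \<in> points S" "(f z, L) \<in> incid T" "f z \<noteq> v"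
    and u: "u \<in> points S" "(f u, K) \<in> incid T" "f u \<noteq> v"
  shows "card (pencil z L) \<le> card (pencil u K)"
proof (rule card_le_if_inj_on_rel[where r = "\<lambda>N R. \<exists>n. (n, N) \<in> incid S \<and> (n, R) \<in> incid S"])
  have zK: "(f z, K) \<notin> incid T" and uL: "(f u, L) \<notin> incid T"
    using T.unique_line v z u by blast+
  show "finite (pencil u K)" by (rule finite_pencil)
  show "\<exists>R. R \<in> pencil u K \<and> (\<exists>n. (n, N) \<in> incid S \<and> (n, R) \<in> incid S)"
    if "N \<in> pencil z L" for N
  proof -
    have N: "(z, N) \<in> incid S" "g N = L" using that by (auto simp: pencil_def)
    then have "(u, N) \<notin> incid S" using incid uL by blast
    then obtain n R where R: "(u, R) \<in> incid S" "(n, R) \<in> incid S" "(n, N) \<in> incid S"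
      using D.projection u(1) D.incid_line N(1) by blast
    have "g R = K"
      using T.projection_unique[OF uL incid[OF R(1)] incid[OF R(2)] _ u(2) v(2,1)] incid[OF R(3)] N(2)
      by blast
    then show ?thesis using R by (auto simp: pencil_def)
  qed
  show "N1 = N2" if "N1 \<in> pencil z L" "N2 \<in> pencil z L" "R \<in> pencil u K"
    "\<exists>n. (n, N1) \<in> incid S \<and> (n, R) \<in> incid S" "\<exists>n. (n, N2) \<in> incid S \<and> (n, R) \<in> incid S"
    for N1 N2 R
  proof -
    have "(z, R) \<notin> incid S" using incid zK that(3) by (auto simp: pencil_def)
    then show ?thesis using D.projection_unique that by (auto simp: pencil_def)
  qed
qed

text \<open>Both pencils are compared with a pencil over a line \<open>K\<close> that meets
  \<open>L\<close> away from \<open>f z\<close> and \<open>f w\<close>.\<close>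

lemma card_pencil_line:
  assumes z: "z \<in> points S" "(f z, L) \<in> incid T" and w: "w \<in> points S" "(f w, L) \<in> incid T"
  shows "card (pencil z L) = card (pencil w L)"
proof -
  obtain v where v: "(v, L) \<in> incid T" "v \<noteq> f z" "v \<noteq> f w"
    using T.third_point T.incid_line z(2) by blast
  obtain K where K: "(v, K) \<in> incid T" "K \<noteq> L" using T.second_line T.incid_point v(1) by blast
  obtain y where y: "(y, K) \<in> incid T" "y \<noteq> v" using T.third_point T.incid_line K(1) by blast
  obtain u where u: "u \<in> points S" "f u = y" using surj_points T.incid_point y(1) by blast
  have "card (pencil x L) = card (pencil u K)" if "x \<in> points S" "(f x, L) \<in> incid T" "f x \<noteq> v" for x
    using card_pencil_le[OF v(1) K(1) K(2)[symmetric] that u(1)]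
      card_pencil_le[OF K(1) v(1) K(2) u(1) _ _ that] u(2) y by (simp add: le_antisym)
  then show ?thesis using z w v by metis
qed

text \<open>\<open>card_pencil_le\<close> does not apply at the common point \<open>f z\<close>, so
  the comparison is made at points over \<open>L\<close> and over \<open>M\<close> with other
  images.\<close>

lemma card_pencil_point:
  assumes z: "z \<in> points S" "(f z, L) \<in> incid T" "(f z, M) \<in> incid T"
  shows "card (pencil z L) = card (pencil z M)"
proof (cases "L = M")
  case False
  obtain y where y: "(y, L) \<in> incid T" "y \<noteq> f z" using T.third_point T.incid_line z(2) by blast
  obtain y' where y': "(y', M) \<in> incid T" "y' \<noteq> f z" using T.third_point T.incid_line z(3) by blast
  obtain w where w: "w \<in> points S" "f w = y" using surj_points T.incid_point y(1) by blast
  obtain u where u: "u \<in> points S" "f u = y'" using surj_points T.incid_point y'(1) by blast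
  have "card (pencil w L) = card (pencil u M)"
    using card_pencil_le[OF z(2,3) False w(1) _ _ u(1)]
      card_pencil_le[OF z(3,2) False[symmetric] u(1) _ _ w(1)] w u y y' by (simp add: le_antisym)
  then show ?thesis
    using card_pencil_line[OF z(1,2) w(1)] card_pencil_line[OF z(1,3) u(1)] w u y y' by simp
qed simp

text \<open>Projection on \<open>V\<close> sends a point of \<open>U\<close> over \<open>z\<close>
  to a point over \<open>u\<close>, since \<open>z\<close> projects to \<open>u\<close> on
  \<open>g V\<close> along \<open>M\<close>. Projecting back on \<open>U\<close> shows
  injectivity.\<close>

lemma card_row_le:
  assumes M: "(z, M) \<in> incid T" "(u, M) \<in> incid T" "z \<noteq> u" "M \<noteq> g U" "M \<noteq> g V"
    and zU: "(z, g U) \<in> incid T" and uV: "(u, g V) \<in> incid T" and V: "V \<in> lines S"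
  shows "card (row U z) \<le> card (row V u)"
proof (rule card_le_if_inj_on_rel[where r = "\<lambda>n q. \<exists>R. (n, R) \<in> incid S \<and> (q, R) \<in> incid S"])
  have zV: "(z, g V) \<notin> incid T" and uU: "(u, g U) \<notin> incid T"
    using T.unique_line M zU uV by blast+
  show "finite (row V u)" by (rule finite_row)
  show "\<exists>q. q \<in> row V u \<and> (\<exists>R. (n, R) \<in> incid S \<and> (q, R) \<in> incid S)" if "n \<in> row U z" for n
  proof -
    have n: "(n, U) \<in> incid S" "f n = z" using that by (auto simp: row_def)
    then have "(n, V) \<notin> incid S" using incid zV by blast
    then obtain q R where R: "(n, R) \<in> incid S" "(q, R) \<in> incid S" "(q, V) \<in> incid S"
      using D.projection V D.incid_point n(1) by blast
    have "f q = u"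
      using T.projection_unique[OF zV _ incid[OF R(2)] incid[OF R(3)] M(1,2) uV] incid[OF R(1)] n(2)
      by blast
    then show ?thesis using R by (auto simp: row_def)
  qed
  show "n1 = n2" if "n1 \<in> row U z" "n2 \<in> row U z" "q \<in> row V u"
    "\<exists>R. (n1, R) \<in> incid S \<and> (q, R) \<in> incid S" "\<exists>R. (n2, R) \<in> incid S \<and> (q, R) \<in> incid S"
    for n1 n2 q
  proof -
    have "(q, U) \<notin> incid S" using incid uU that(3) by (auto simp: row_def)
    then show ?thesis using D.projection_unique that unfolding row_def by blast
  qed
qed

lemma card_row_eq:
  assumes M: "(z, M) \<in> incid T" "(u, M) \<in> incid T" "z \<noteq> u" "M \<noteq> g U" "M \<noteq> g V"
    and zU: "(z, g U) \<in> incid T" "U \<in> lines S" and uV: "(u, g V) \<in> incid T" "V \<in> lines S"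
  shows "card (row U z) = card (row V u)"
  using card_row_le[OF M zU(1) uV] card_row_le[OF M(2,1) M(3)[symmetric] M(5,4) uV(1) zU]
  by (rule le_antisym)

text \<open>Both rows are compared with a row over a point \<open>u\<close> collinear with
  \<open>z\<close>, on a line whose image avoids \<open>z\<close>.\<close>

lemma card_row_line:
  assumes U: "U \<in> lines S" "V \<in> lines S" "g U = g V" and z: "(z, g U) \<in> incid T"
  shows "card (row U z) = card (row V z)"
proof -
  obtain M where M: "(z, M) \<in> incid T" "M \<noteq> g U" using T.second_line T.incid_point z by blast
  obtain u where u: "(u, M) \<in> incid T" "u \<noteq> z" using T.third_point T.incid_line M(1) by blast
  obtain K where K: "(u, K) \<in> incid T" "K \<noteq> M" using T.second_line T.incid_point u(1) by blast
  obtain W where W: "W \<in> lines S" "g W = K" using surj_lines T.incid_line K(1) by blast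
  have "card (row X z) = card (row W u)" if "X \<in> lines S" "g X = g U" for X
    using card_row_eq[OF M(1) u(1) u(2)[symmetric], of X W] M(2) K z W that by auto
  then show ?thesis using U by metis
qed

text \<open>Let L be the image of U, M another line through \<open>f x\<close>, k the size of the pencils over L
  and over M, and a and b the numbers of points over \<open>f x\<close> on a line over L and over M. Projecting
  the fibre of \<open>f x\<close> on a line whose image meets L in another point bounds its size by kab;
  counting the points projected to each point of U bounds it from below, which forces k = 1.\<close>

theorem inj_on_pencils:
  assumes U: "(x, U) \<in> incid S" and V: "(x, V) \<in> incid S" and gUV: "g U = g V"
  shows "U = V"
proof (rule ccontr)
  assume "U \<noteq> V"
  define z where "z = f x"
  define L where "L = g U"
  define F where "F = {y \<in> points S. f y = z}"
  have xS: "x \<in> points S" and US: "U \<in> lines S" using D.incid_point D.incid_line U by blast+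
  have zL: "(z, L) \<in> incid T" using incid U by (auto simp: z_def L_def)
  define k where "k = card (pencil x L)"
  have "{U, V} \<subseteq> pencil x L" using U V gUV by (auto simp: pencil_def L_def)
  then have "card {U, V} \<le> k" unfolding k_def by (rule card_mono[OF finite_pencil])
  then have k2: "2 \<le> k" using \<open>U \<noteq> V\<close> by simp
  obtain M where M: "(z, M) \<in> incid T" "M \<noteq> L" using T.second_line T.incid_point zL by blast
  have kL: "card (pencil w L) = k" if "w \<in> points S" "(f w, L) \<in> incid T" for w
    using card_pencil_line[OF that xS] zL unfolding k_def z_def by blast
  have kM: "card (pencil w M) = k" if "w \<in> F" for w
  proof -
    have w: "w \<in> points S" "f w = z" using that by (simp_all add: F_def)
    then show ?thesis using card_pencil_point[of w L M] kL[of w] M(1) zL by metis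
  qed
  define a where "a = card (row U z)"
  have aL: "card (row N z) = a" if "N \<in> lines S" "g N = L" for N
    using card_row_line[OF that(1) US] that zL unfolding a_def L_def by metis
  have "x \<in> row U z" using U by (simp add: row_def z_def)
  then have a1: "1 \<le> a" using finite_row by (simp add: a_def Suc_le_eq card_gt_0_iff) blast
  obtain p where p: "(p, L) \<in> incid T" "p \<noteq> z" using T.third_point T.incid_line zL by blast
  obtain K where K: "(p, K) \<in> incid T" "K \<noteq> L" using T.second_line T.incid_point p by blast
  obtain W where W: "W \<in> lines S" "g W = K" using surj_lines T.incid_line K by blast
  \<comment> \<open>By the next fact this is also the number of points over \<open>z\<close> on any
    line over \<open>M\<close>: both are related through \<open>L\<close>, which joins
    \<open>z\<close> to \<open>p\<close>.\<close>
  define b where "b = card (row W p)"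
  have bM: "card (row N z) = b" if "N \<in> lines S" "g N = M" for N
    using card_row_eq[OF zL p(1) p(2)[symmetric], of N W] that M K W unfolding b_def by metis
  have finF: "finite F" using finite_points by (simp add: F_def)

  have zK: "(z, K) \<notin> incid T" using T.unique_line zL p K by blast
  \<comment> \<open>Since \<open>z\<close> projects to \<open>p\<close> on \<open>K\<close> along
    \<open>L\<close>, each point of the fibre projects on \<open>W\<close> to a point over
    \<open>p\<close> along a line over \<open>L\<close>.\<close>
  have "F \<subseteq> (\<Union>q\<in>row W p. \<Union>N\<in>pencil q L. row N z)"
  proof
    fix y assume "y \<in> F"
    then have y: "y \<in> points S" "f y = z" by (auto simp: F_def)
    then have "(y, W) \<notin> incid S" using incid W zK by blast
    then obtain q N where N: "(y, N) \<in> incid S" "(q, N) \<in> incid S" "(q, W) \<in> incid S"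
      using D.projection y W by blast
    have "f q = p \<and> g N = L"
      using T.projection_unique[OF zK _ incid[OF N(2)] _ zL p(1) K(1)] incid[OF N(1)] incid[OF N(3)]
        y W by simp
    then show "y \<in> (\<Union>q\<in>row W p. \<Union>N\<in>pencil q L. row N z)"
      using N y by (auto simp: row_def pencil_def)
  qed
  then have "card F \<le> card (\<Union>q\<in>row W p. \<Union>N\<in>pencil q L. row N z)"
    by (intro card_mono finite_UN_I finite_row finite_pencil)
  also have "\<dots> \<le> (\<Sum>q\<in>row W p. card (\<Union>N\<in>pencil q L. row N z))"
    by (rule card_UN_le[OF finite_row])
  also have "\<dots> \<le> (\<Sum>q\<in>row W p. k * a)"
  proof (rule sum_mono)
    fix q assume "q \<in> row W p"
    then have "q \<in> points S" "f q = p" using D.incid_point by (auto simp: row_def)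
    then have "card (pencil q L) = k" using kL p by blast
    moreover have "card (row N z) = a" if "N \<in> pencil q L" for N
      using aL that D.incid_line by (auto simp: pencil_def)
    ultimately show "card (\<Union>N\<in>pencil q L. row N z) \<le> k * a"
      using card_UN_le[OF finite_pencil, of "\<lambda>N. row N z" q L] by simp
  qed
  also have "\<dots> = b * (k * a)" by (simp add: b_def)
  finally have upper: "card F \<le> b * (k * a)" .

  define R where "R = {w. (w, U) \<in> incid S}"
  define C where "C w = (pencil w L - {U}) \<union> pencil w M" for w
  \<comment> \<open>Triples of a point \<open>y\<close> of the fibre off \<open>U\<close>, its
    projection \<open>w\<close> on \<open>U\<close>, and the joining line \<open>N\<close>; by
    uniqueness of projection \<open>y\<close> determines the triple.\<close>
  define X where "X = (SIGMA w:R. SIGMA N:C w. row N z - {w})"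
  have finR: "finite R" unfolding R_def
    by (rule finite_subset[OF _ finite_points]) (auto simp: D.incid_point)
  have finC: "finite (C w)" for w by (simp add: C_def finite_pencil)
  have rowR: "row U z \<subseteq> R" by (auto simp: row_def R_def)
  have C: "(w, N) \<in> incid S" "N \<noteq> U" "N \<in> lines S" if "N \<in> C w" for w N
    using that M(2) D.incid_line by (auto simp: C_def pencil_def L_def)
  have X: "(y, U) \<notin> incid S" "(y, N) \<in> incid S" "(w, N) \<in> incid S" "(w, U) \<in> incid S" "y \<in> F"
    if "(w, N, y) \<in> X" for w N y
  proof -
    have w: "(w, U) \<in> incid S" "N \<in> C w" "(y, N) \<in> incid S" "f y = z" "y \<noteq> w"
      using that by (auto simp: X_def R_def row_def)
    then show "(y, N) \<in> incid S" "(w, N) \<in> incid S" "(w, U) \<in> incid S" using C by blast+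
    show "(y, U) \<notin> incid S" using D.unique_line[of y U w N] C[OF w(2)] w by blast
    show "y \<in> F" using w D.incid_point by (auto simp: F_def)
  qed
  have X_unique: "w = w' \<and> N = N'" if 1: "(w, N, y) \<in> X" and 2: "(w', N', y) \<in> X" for w N w' N' y
    using D.projection_unique[OF X(1)[OF 1] X(2)[OF 1] X(3)[OF 1] X(4)[OF 1] X(2)[OF 2] X(3)[OF 2] X(4)[OF 2]] .
  have "inj_on (\<lambda>(w, N, y). y) X"
    by (auto intro!: inj_onI dest: X_unique)
  moreover have "y \<in> F - row U z" if "(w, N, y) \<in> X" for w N y
    using X(1)[OF that] X(5)[OF that] by (simp add: row_def)
  then have "(\<lambda>(w, N, y). y) ` X \<subseteq> F - row U z" by auto
  ultimately have "card X \<le> card (F - row U z)"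
    using finF by (intro card_inj_on_le) auto
  also have "\<dots> = card F - a"
    using rowR finite_row D.incid_point by (subst card_Diff_subset) (auto simp: a_def row_def F_def)
  finally have lower: "card X \<le> card F - a" .

  have cardX: "card X = (\<Sum>w\<in>R. \<Sum>N\<in>C w. card (row N z - {w}))"
    unfolding X_def using finR finC finite_row by (simp add: card_SigmaI)
  have pencil_U: "card (pencil w L - {U}) = k - 1" if "w \<in> R" for w
    using that kL[of w] incid[of w U] D.incid_point[of w U] finite_pencil
    by (simp add: R_def card_Diff_singleton pencil_def L_def)
  \<comment> \<open>Here \<open>w\<close> itself is over \<open>z\<close> and is removed from each
    row. There are \<open>k - 1\<close> lines over \<open>L\<close> besides \<open>U\<close>, and
    \<open>k\<close> lines over \<open>M\<close>.\<close>
  have in_F: "(\<Sum>N\<in>C w. card (row N z - {w})) = (k - 1) * (a - 1) + k * (b - 1)" if "w \<in> row U z" for w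
  proof -
    have w: "w \<in> R" "f w = z" "w \<in> F" using that rowR D.incid_point by (auto simp: row_def F_def)
    have "(\<Sum>N\<in>C w. card (row N z - {w})) =
        (\<Sum>N\<in>pencil w L - {U}. card (row N z - {w})) + (\<Sum>N\<in>pencil w M. card (row N z - {w}))"
      unfolding C_def using M(2) finite_pencil by (intro sum.union_disjoint) (auto simp: pencil_def)
    also have "(\<Sum>N\<in>pencil w L - {U}. card (row N z - {w})) = (\<Sum>N\<in>pencil w L - {U}. a - 1)"
      using w aL D.incid_line by (intro sum.cong) (auto simp: pencil_def row_def card_Diff_singleton)
    also have "(\<Sum>N\<in>pencil w M. card (row N z - {w})) = (\<Sum>N\<in>pencil w M. b - 1)"
      using w bM D.incid_line by (intro sum.cong) (auto simp: pencil_def row_def card_Diff_singleton)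
    finally show ?thesis using pencil_U[OF w(1)] kM[OF w(3)] by simp
  qed
  have off_F: "(\<Sum>N\<in>C w. card (row N z - {w})) = (k - 1) * a" if "w \<in> R - row U z" for w
  proof -
    have w: "w \<in> R" "f w \<noteq> z" using that by (auto simp: row_def R_def)
    have fw: "(f w, L) \<in> incid T" using w(1) incid by (auto simp: R_def L_def)
    \<comment> \<open>The image of \<open>w\<close> is on \<open>L\<close> but is not
      \<open>z\<close>, the only common point of \<open>L\<close> and \<open>M\<close>.\<close>
    have "pencil w M = {}"
      using T.unique_line[OF zL fw M(1) _ w(2)[symmetric]] incid M(2) by (auto simp: pencil_def)
    then have "(\<Sum>N\<in>C w. card (row N z - {w})) = (\<Sum>N\<in>pencil w L - {U}. a)"
      unfolding C_def using w aL D.incid_line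
      by (intro sum.cong) (auto simp: pencil_def row_def)
    then show ?thesis using pencil_U[OF w(1)] by simp
  qed
  define n where "n = card R"
  have "a \<le> n" unfolding a_def n_def by (rule card_mono[OF finR rowR])
  have "card X = (\<Sum>w\<in>R - row U z. \<Sum>N\<in>C w. card (row N z - {w})) +
      (\<Sum>w\<in>row U z. \<Sum>N\<in>C w. card (row N z - {w}))"
    unfolding cardX by (rule sum.subset_diff[OF rowR finR])
  also have "\<dots> = (n - a) * ((k - 1) * a) + a * ((k - 1) * (a - 1) + k * (b - 1))"
    using in_F off_F rowR finite_row by (simp add: n_def a_def card_Diff_subset)
  finally have sum_X: "card X = (n - a) * ((k - 1) * a) + a * ((k - 1) * (a - 1) + k * (b - 1))" .
  have aF: "a \<le> card F"
    unfolding a_def using finF D.incid_point by (intro card_mono) (auto simp: row_def F_def)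
  \<comment> \<open>If \<open>b\<close> were 0, the upper bound would make the nonempty fibre empty.
    Thus the truncated subtractions \<open>a - 1\<close> and \<open>b - 1\<close> are exact.\<close>
  then have b1: "1 \<le> b" using upper a1 by (cases b) auto
  have "a + card X \<le> b * (k * a)" using lower upper aF by linarith
  then have "a * (1 + (n - a) * (k - 1) + (k - 1) * (a - 1) + k * (b - 1)) \<le> a * (b * k)"
    unfolding sum_X by (simp add: algebra_simps)
  then have count: "1 + (n - a) * (k - 1) + (k - 1) * (a - 1) + k * (b - 1) \<le> b * k"
    using a1 unfolding nat_mult_le_cancel_disj by linarith
  obtain y1 where y1: "(y1, U) \<in> incid S" "y1 \<noteq> x" using D.third_point US by blast
  obtain y2 where y2: "(y2, U) \<in> incid S" "y2 \<noteq> x" "y2 \<noteq> y1" using D.third_point US by blast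
  have "card {x, y1, y2} \<le> n"
    unfolding n_def using finR U y1 y2 by (intro card_mono) (auto simp: R_def)
  then have n3: "3 \<le> n" using y1 y2 by simp
  \<comment> \<open>The count reduces to \<open>(n - 1) * (k - 1) \<le> k - 1\<close>, with
    \<open>n - 1 = c + a'\<close> and \<open>k - 1 = k' + 1\<close>; this contradicts
    \<open>3 \<le> n\<close> and \<open>2 \<le> k\<close>.\<close>
  obtain k' a' b' c where "k = k' + 2" "a = a' + 1" "b = b' + 1" "n = a + c"
    using k2 a1 b1 \<open>a \<le> n\<close> by (metis le_add_diff_inverse le_add_diff_inverse2)
  then have "(c + a') * (k' + 1) \<le> 1 * (k' + 1)" "2 \<le> c + a'"
    using count n3 by (simp_all add: algebra_simps)
  then show False using mult_le_cancel2[of "c + a'" "k' + 1" 1] by linarith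
qed

end

subsection \<open>Morphisms onto a hyperplane\<close>

locale hyperplane_morphism = D: hyperplane S G + T: hyperplane T H
  for S G :: "('p, 'l) geometry" and T H :: "('q, 'm) geometry" +
  fixes f :: "'p \<Rightarrow> 'q" and g :: "'l \<Rightarrow> 'm"
  assumes incid: "(x, U) \<in> incid S \<Longrightarrow> (f x, g U) \<in> incid T"
    and image_points: "f ` points G = points H"
    and image_lines: "g ` lines G = lines H"
begin

section \<open>Lifting from the hyperplane and spreading the image\<close>

lemma lift_point: "y \<in> points H \<Longrightarrow> \<exists>x\<in>points G. f x = y"
  unfolding image_points[symmetric] by blast

lemma lift_line: "M \<in> lines H \<Longrightarrow> \<exists>U\<in>lines G. g U = M"
  unfolding image_lines[symmetric] by blast

text \<open>The point \<open>h\<close> of \<open>H\<close> on \<open>M\<close> has a preimage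
  \<open>z\<close>. As \<open>h\<close> projects to \<open>w\<close> on \<open>g U\<close> along
  \<open>M\<close>, projecting \<open>z\<close> on \<open>U\<close> yields preimages of
  \<open>w\<close> and \<open>M\<close>.\<close>

lemma image_spreads:
  assumes U: "U \<in> lines S" and w: "(w, g U) \<in> incid T" "w \<notin> points H"
    and M: "(w, M) \<in> incid T" "M \<noteq> g U"
  shows "w \<in> f ` points S" "M \<in> g ` lines S"
proof -
  obtain h where h: "h \<in> points H" "(h, M) \<in> incid T" using T.line_meets T.incid_line M(1) by blast
  obtain z where z: "z \<in> points G" "f z = h" using lift_point h(1) by blast
  have off: "(h, g U) \<notin> incid T" using T.unique_line[of w M h "g U"] h w M by blast
  then have "(z, U) \<notin> incid S" using incid z(2) by blast
  then obtain v V where V: "(z, V) \<in> incid S" "(v, V) \<in> incid S" "(v, U) \<in> incid S"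
    using D.projection U z(1) D.points_subset by blast
  have "(h, g V) \<in> incid T" using incid[OF V(1)] z(2) by simp
  then have "f v = w \<and> g V = M"
    using T.projection_unique[OF off _ incid[OF V(2)] incid[OF V(3)] h(2) M(1) w(1)] by blast
  then show "w \<in> f ` points S" "M \<in> g ` lines S"
    using V D.incid_point D.incid_line by blast+
qed

lemma surjective_if_line_off:
  assumes U: "U \<in> lines S" "g U \<in> lines T" "g U \<notin> lines H"
  shows "points T \<subseteq> f ` points S" "lines T \<subseteq> g ` lines S"
proof -
  \<comment> \<open>Lying on the image of a line is what propagates: off \<open>H\<close> it makes
    all lines through \<open>w\<close> images, so it passes to every point collinear with
    \<open>w\<close>.\<close>
  define P where "P w \<longleftrightarrow> (\<exists>V\<in>lines S. (w, g V) \<in> incid T)" for w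
  have lines: "M \<in> g ` lines S" if "P w" "w \<notin> points H" "(w, M) \<in> incid T" for w M
    using that image_spreads(2)[of _ w M] unfolding P_def by blast
  have points: "w \<in> f ` points S" if w: "P w" "w \<notin> points H" for w
  proof -
    obtain V where V: "V \<in> lines S" "(w, g V) \<in> incid T" using w(1) unfolding P_def by blast
    obtain M where "(w, M) \<in> incid T" "M \<noteq> g V" using T.second_line T.incid_point V(2) by blast
    then show ?thesis using image_spreads(1)[OF V w(2)] by blast
  qed
  obtain y where y: "(y, g U) \<in> incid T" "y \<notin> points H" using T.point_off_hyperplane U by blast
  have Py: "P y" using U y unfolding P_def by blast
  have P: "P w" if w: "w \<in> points T" "w \<notin> points H" for w
  proof (rule T.complement_connected[OF T.incid_point[OF y(1)] y(2), of P, OF Py _ w])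
    fix x z M
    assume "P x" "x \<notin> points H" "(x, M) \<in> incid T" "(z, M) \<in> incid T"
    then show "P z" using lines[of x M] unfolding P_def by blast
  qed
  show "points T \<subseteq> f ` points S"
    using P points lift_point D.points_subset by blast
  show "lines T \<subseteq> g ` lines S"
  proof
    fix M assume M: "M \<in> lines T"
    show "M \<in> g ` lines S"
    proof (cases "M \<in> lines H")
      case True
      then show ?thesis using lift_line D.lines_subset by blast
    next
      case False
      then obtain w where "(w, M) \<in> incid T" "w \<notin> points H" using T.point_off_hyperplane M by blast
      then show ?thesis using P lines T.incid_point by blast
    qed
  qed
qed

text \<open>Otherwise the map is an epimorphism onto the quadrangle \<open>H\<close>, and a line
  outside \<open>G\<close> gets the same image as a line of \<open>G\<close> through a common point,
  against \<open>inj_on_pencils\<close>.\<close>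

lemma line_off_exists:
  assumes fin: "finite_geometry S" and geo: "point_line_geometry S"
    and nB: "\<not> hyperplane_type_B H T"
  shows "\<exists>U\<in>lines S. g U \<notin> lines H"
proof (rule ccontr)
  assume "\<not> ?thesis"
  then have gH: "g U \<in> lines H" if "U \<in> lines S" for U using that by blast
  obtain U where U: "U \<in> lines S" "U \<notin> lines G" using D.line_off_hyperplane geo by blast
  have "lines H \<noteq> {}" using gH U by blast
  then interpret Q: quadrangle H using T.quadrangle_hyperplane nB by blast
  have incH: "(f x, g V) \<in> incid H" if "(x, V) \<in> incid S" for x V
    using incid[OF that] gH D.incid_line[OF that] T.point_on_line T.incid_iff by blast
  interpret E: epimorphism S H f g
  proof
    show "\<exists>x\<in>points S. f x = y" if "y \<in> points H" for y
      using lift_point[OF that] D.points_subset by blast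
    show "\<exists>V\<in>lines S. g V = M" if "M \<in> lines H" for M
      using lift_line[OF that] D.lines_subset by blast
  qed (use incH fin in \<open>auto simp: finite_geometry_def\<close>)
  obtain x where x: "x \<in> points G" "(x, U) \<in> incid S" using D.line_meets U by blast
  obtain p where p: "(p, g U) \<in> incid H" "p \<noteq> f x" using Q.third_point gH U by blast
  obtain K where K: "(p, K) \<in> incid H" "K \<noteq> g U" using Q.second_line Q.incid_point p by blast
  \<comment> \<open>Taking \<open>W\<close> in \<open>G\<close> puts the line \<open>V\<close> from
    \<open>x\<close> to \<open>W\<close> in \<open>G\<close>. Its image joins \<open>f x\<close> to
    \<open>K\<close>, hence is \<open>g U\<close>.\<close>
  obtain W where W: "W \<in> lines G" "g W = K" using lift_line Q.incid_line K(1) by blast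
  have off: "(f x, K) \<notin> incid H" using Q.unique_line incH x(2) p K by blast
  then have "(x, W) \<notin> incid S" using incH W by blast
  then obtain w V where V: "V \<in> lines G" "(x, V) \<in> incid S" "(w, V) \<in> incid S" "(w, W) \<in> incid S"
    using D.projection_in_hyperplane x(1) W(1) by blast
  have "(f w, K) \<in> incid H" using incH V(4) W(2) by blast
  then have "g V = g U"
    using Q.projection_unique[OF off incH[OF V(2)] incH[OF V(3)] _ incH[OF x(2)] p(1) K(1)] by blast
  then have "V = U" using E.inj_on_pencils V(2) x(2) by blast
  then show False using V(1) U(2) by blast
qed

end

theorem mainTheorem7:
  fixes \<Delta> :: "('p, 'l) geometry" and \<Delta>' :: "('q, 'm) geometry"
    and G :: "('p, 'l) geometry" and G' :: "('q, 'm) geometry"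
    and \<phi>\<^sub>P :: "'p \<Rightarrow> 'q" and \<phi>\<^sub>L :: "'l \<Rightarrow> 'm"
  assumes "finite_geometry \<Delta>" and "generalized_quadrangle \<Delta>"
    and "finite_geometry \<Delta>'" and "generalized_quadrangle \<Delta>'"
    and "morphism \<Delta> \<Delta>' \<phi>\<^sub>P \<phi>\<^sub>L"
    and "geometrical_hyperplane G \<Delta>" and "geometrical_hyperplane G' \<Delta>'"
    and "maps_onto G G' \<phi>\<^sub>P \<phi>\<^sub>L"
    and "\<not> hyperplane_type_B G' \<Delta>'"
  shows "maps_onto \<Delta> \<Delta>' \<phi>\<^sub>P \<phi>\<^sub>L"
proof -
  interpret D: quadrangle \<Delta> using generalized_quadrangle_quadrangle assms(2) .
  interpret T: quadrangle \<Delta>' using generalized_quadrangle_quadrangle assms(4) .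
  have into: "\<phi>\<^sub>P ` points \<Delta> \<subseteq> points \<Delta>'" "\<phi>\<^sub>L ` lines \<Delta> \<subseteq> lines \<Delta>'"
    using assms(5) unfolding morphism_def by simp_all
  have incid: "(\<phi>\<^sub>P x, \<phi>\<^sub>L U) \<in> incid \<Delta>'" if "(x, U) \<in> incid \<Delta>" for x U
    using assms(5) that D.incid_point[OF that] D.incid_line[OF that] unfolding morphism_def by simp
  interpret hyperplane_morphism \<Delta> G \<Delta>' G' \<phi>\<^sub>P \<phi>\<^sub>L
    using assms(6-8) by unfold_locales (simp_all add: maps_onto_def incid)
  have "point_line_geometry \<Delta>"
    using D.incid_point D.incid_line unfolding point_line_geometry_def by auto
  then obtain U where "U \<in> lines \<Delta>" "\<phi>\<^sub>L U \<notin> lines G'"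
    using line_off_exists assms(1,9) by blast
  then show ?thesis
    using surjective_if_line_off[of U] into unfolding maps_onto_def by (simp add: subset_antisym image_subset_iff)
qed

end
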